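(* For all $n\ge1$ and $d\ge0$, the entries of the $f$-vector and primitive $f$-vector of $CRY_n$ satisfy $$f^{(n)}_d=\sum_{i=0}^{n-1}\binom{n-1}{i}\,\widetilde f^{(n-i)}_d.$$
   Context: For $n\ge1$, $K_{n+1}$ is the directed graph on $v_1,\dots,v_{n+1}$ with one edge $(v_i,v_j)$ for each $1\le i<j\le n+1$. A unit flow on $K_{n+1}$ is a function $f:E(K_{n+1})\to\mathbb R_{\ge0}$ such that $\sum_{j>i}f(v_i,v_j)-\sum_{k<i}f(v_k,v_i)$ equals $1$ for $i=1$ and $0$ for $2\le i\le n$. $CRY_n=\mathrm{Flow}_n(1,0,\dots,0)\subset\mathbb R^{E(K_{n+1})}$ is the polytope of all unit flows, and $f^{(n)}_d$ is its number of $d$-dimensional faces (the polytope itself counts as a face). A subgraph $H\subseteq K_{n+1}$ is valid if its edge set is the support $\{e:f(e)>0\}$ of some unit flow (its vertex set being the set of endpoints of these edges). $H$ is primitive if it is connected (as an undirected graph) and $V(H)=\{v_1,\dots,v_{n+1}\}$. The first Betti number is $\beta_1(H)=|E(H)|-|V(H)|+c(H)$, with $c(H)$ the number of connected components. $\widetilde f^{(n)}_d$ is the number of valid primitive subgraphs $H$ of $K_{n+1}$ with $\beta_1(H)=d$. *)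

theory Defs
  imports "HOL-Analysis.Analysis" "HOL-Analysis.Finite_Function_Topology" "Graph_Theory.Graph_Theory"
begin

text \<open>The digraph $K_{n+1}$; the vertex $v_i$ is the number $i$.\<close>

definition complete_dag :: "nat \<Rightarrow> nat pair_pre_digraph" where
  "complete_dag n = \<lparr> pverts = {1..n+1}, parcs = {(i, j). 1 \<le> i \<and> i < j \<and> j \<le> n + 1} \<rparr>"

text \<open>
  The space $\mathbb{R}^{E(K_{n+1})}$ is realised as the subspace of the finitely supported
  functions on pairs of naturals that vanish outside the edges of $K_{n+1}$. In this way one real
  vector space serves for all $n$. There is no condition on the netflow at the sink $n+1$.
\<close>

definition netflow :: "nat \<Rightarrow> (nat \<times> nat \<Rightarrow>\<^sub>0 real) \<Rightarrow> nat \<Rightarrow> real" where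
  "netflow n f i =
     (\<Sum>j\<in>{i<..n+1}. Poly_Mapping.lookup f (i, j)) - (\<Sum>k\<in>{1..<i}. Poly_Mapping.lookup f (k, i))"

definition unit_flow :: "nat \<Rightarrow> (nat \<times> nat \<Rightarrow>\<^sub>0 real) \<Rightarrow> bool" where
  "unit_flow n f \<longleftrightarrow>
     Poly_Mapping.keys f \<subseteq> parcs (complete_dag n) \<and>
     (\<forall>e\<in>parcs (complete_dag n). 0 \<le> Poly_Mapping.lookup f e) \<and>
     (\<forall>i\<in>{1..n}. netflow n f i = (if i = 1 then 1 else 0))"

definition CRY :: "nat \<Rightarrow> (nat \<times> nat \<Rightarrow>\<^sub>0 real) set" where
  "CRY n = {f. unit_flow n f}"

text \<open>
  The library's \<^const>\<open>aff_dim\<close> is restricted to the class of Euclidean spaces, to which the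
  space above does not belong. The following is the dimension of the affine hull of a set with
  finite-dimensional span in any real vector space: the dimension of its direction space, and
  $-1$ for the empty set.
\<close>

definition affine_dim :: "'a::real_vector set \<Rightarrow> int" where
  "affine_dim S = (if S = {} then -1 else int (dim {x - y | x y. x \<in> S \<and> y \<in> S}))"

lemma affine_dim_eq_aff_dim:
  fixes S :: "'a::euclidean_space set"
  shows "affine_dim S = aff_dim S"
proof (cases "S = {}")
  case False
  then obtain a where a: "a \<in> S" by blast
  let ?D = "{x - y | x y. x \<in> S \<and> y \<in> S}"
  have sub: "(\<lambda>x. x - a) ` S \<subseteq> ?D"
    using a by blast
  have "?D \<subseteq> span ((\<lambda>x. x - a) ` S)"
  proof
    fix z assume "z \<in> ?D"
    then obtain x y where z: "z = x - y" and "x \<in> S" "y \<in> S" by blast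
    then have "(x - a) - (y - a) \<in> span ((\<lambda>x. x - a) ` S)"
      by (intro span_diff span_base imageI)
    then show "z \<in> span ((\<lambda>x. x - a) ` S)"
      by (simp add: z)
  qed
  then have "dim ?D \<le> dim ((\<lambda>x. x - a) ` S)"
    using dim_subset[of ?D "span ((\<lambda>x. x - a) ` S)"] by (simp only: dim_span)
  moreover have "dim ((\<lambda>x. x - a) ` S) \<le> dim ?D"
    using sub by (rule dim_subset)
  ultimately have "dim ?D = dim ((\<lambda>x. x - a) ` S)"
    by (rule antisym)
  also have "int \<dots> = aff_dim S"
    using aff_dim_eq_dim_subtract[of a S] a by (simp add: hull_inc)
  finally show ?thesis
    using False by (simp add: affine_dim_def)
qed (simp add: affine_dim_def)

text \<open>
  Faces in the sense of \<^const>\<open>face_of\<close> include the polytope itself and the empty set; the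
  latter has dimension $-1$ and is never counted.
\<close>

definition f_vector :: "nat \<Rightarrow> nat \<Rightarrow> nat" where
  "f_vector n d = card {F. F face_of CRY n \<and> affine_dim F = int d}"

definition valid_subgraph :: "nat \<Rightarrow> nat pair_pre_digraph \<Rightarrow> bool" where
  "valid_subgraph n H \<longleftrightarrow>
     subgraph (with_proj H) (with_proj (complete_dag n)) \<and>
     (\<exists>f. unit_flow n f \<and> parcs H = {e \<in> parcs (complete_dag n). 0 < Poly_Mapping.lookup f e}) \<and>
     pverts H = fst ` parcs H \<union> snd ` parcs H"

text \<open>\<^const>\<open>Digraph_Component.connected\<close> is connectedness of the underlying undirected graph.\<close>

definition primitive_subgraph :: "nat \<Rightarrow> nat pair_pre_digraph \<Rightarrow> bool" where
  "primitive_subgraph n H \<longleftrightarrow>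
     Digraph_Component.connected (with_proj H) \<and> pverts H = pverts (complete_dag n)"

text \<open>
  The connected components of a digraph, seen as an undirected graph, are the strongly connected
  components of its symmetrisation.
\<close>

definition num_components :: "nat pair_pre_digraph \<Rightarrow> nat" where
  "num_components H = card (pre_digraph.sccs (with_proj (mk_symmetric (with_proj H))))"

definition betti1 :: "nat pair_pre_digraph \<Rightarrow> int" where
  "betti1 H = int (card (parcs H)) - int (card (pverts H)) + int (num_components H)"

definition primitive_f_vector :: "nat \<Rightarrow> nat \<Rightarrow> nat" where
  "primitive_f_vector n d =
     card {H. valid_subgraph n H \<and> primitive_subgraph n H \<and> betti1 H = int d}"

end

theory Submission
  imports Defs
begin

text \<open>
  A nonempty face of the flow polytope is determined by the common support of its relative interior
  points, so faces correspond to supports \<open>E\<close> of unit flows. The direction space of the face is the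
  space of circulations on \<open>E\<close>. Since every vertex other than the source has an incoming edge,
  \<open>E\<close> is connected, and the fundamental cycles of a spanning tree show that the dimension is
  $|E| - |V(E)| + 1 = \beta_1(E)$. A support always meets the source and the sink; choosing which set
  \<open>U\<close> of the $n - 1$ inner vertices it misses and renumbering the others monotonically turns it
  into a primitive subgraph of the complete graph on $n + 1 - |U|$ vertices.
\<close>

section \<open>Connected components\<close>

text \<open>Both sides reduce to counting edge sets \<open>E\<close> with
  \<open>|E| + 1 = |V(E)| + d\<close>. For a face this equation states the dimension; for a
  primitive subgraph it states the Betti number, since connectivity comes for free. Relative
  interiors are handled without topology. Flow values are nonnegative, so a strict convex
  combination of two flows has the union of their supports. There are only finitely many supports,
  so a nonempty face contains a flow of maximal support \<open>E\<close>. That flow is positive on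
  all of \<open>E\<close> and can therefore be moved slightly along every circulation on
  \<open>E\<close>; this yields both the dimension and the recovery of the face from
  \<open>E\<close>. All edges go from a smaller to a larger number, so any choice of one incoming
  edge per non-root vertex is already a spanning tree: no cycle can arise. The renumbering has to be
  increasing because the order of the vertices decides the direction of the edges, and it has to
  respect source and sink because the flow conditions single them out. The binomial coefficient
  counts the sets of missed inner vertices of a given size.\<close>

definition edge_verts :: "('a \<times> 'a) set \<Rightarrow> 'a set" where
  "edge_verts E = fst ` E \<union> snd ` E"

text \<open>Components are maximal with respect to their vertex sets, and \<open>G\<close> itself
  competes, so each one has all vertices of \<open>G\<close>; being induced, it then has all arcs
  too.\<close>

lemma sccs_strongly_connected:
  assumes "wf_digraph G" "strongly_connected G"
  shows "pre_digraph.sccs G = {G}"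
proof -
  interpret wf_digraph G by fact
  have ind: "induced_subgraph G G"
    using assms(1) wellformed by (auto simp: induced_subgraph_def subgraph_def compatible_def)
  have "H = G" if "H \<in> sccs" for H
  proof -
    have H: "induced_subgraph H G" "\<not> verts H \<subset> verts G"
      using that ind assms(2) by (auto simp: sccs_def)
    then have "verts H = verts G" by (auto simp: induced_subgraph_def subgraph_def)
    then have "arcs H = arcs G" "tail H = tail G" "head H = head G"
      using H(1) wellformed by (auto simp: induced_subgraph_def subgraph_def compatible_def)
    then show ?thesis using \<open>verts H = verts G\<close> by simp
  qed
  moreover have "G \<in> sccs"
    using ind assms(2) by (auto simp: sccs_def induced_subgraph_def subgraph_def)
  ultimately show ?thesis by blast
qed

lemma num_components_connected:
  assumes "pair_wf_digraph H" "Digraph_Component.connected (with_proj H)"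
  shows "num_components H = 1"
proof -
  interpret pair_wf_digraph H by fact
  have "pair_wf_digraph (mk_symmetric (with_proj H))"
    by (rule wellformed_mk_symmetric)
  then interpret S: pair_wf_digraph "mk_symmetric (with_proj H)" .
  show ?thesis
    using sccs_strongly_connected[OF S.wf_digraph_axioms] assms(2)
    by (simp add: num_components_def connected_def)
qed

text \<open>Following incoming edges leads from every vertex down to the vertex 1.\<close>

lemma connected_if_incoming:
  fixes H :: "nat pair_pre_digraph"
  assumes wf: "pair_wf_digraph H" and one: "1 \<in> pverts H"
    and less: "\<And>i j. (i, j) \<in> parcs H \<Longrightarrow> i < j"
    and inc: "\<And>j. j \<in> pverts H \<Longrightarrow> j \<noteq> 1 \<Longrightarrow> \<exists>i. (i, j) \<in> parcs H"
  shows "Digraph_Component.connected (with_proj H)"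
proof -
  interpret pair_wf_digraph H by fact
  have "pair_wf_digraph (mk_symmetric (with_proj H))"
    by (rule wellformed_mk_symmetric)
  then interpret S: pair_wf_digraph "mk_symmetric (with_proj H)" .
  have sym: "(i, j) \<in> parcs (mk_symmetric (with_proj H))" "(j, i) \<in> parcs (mk_symmetric (with_proj H))"
    if "(i, j) \<in> parcs H" for i j
    using that by (auto simp: parcs_mk_symmetric intro!: bexI[of _ "(i, j)"])
  have arc: "i \<rightarrow>\<^sup>*\<^bsub>mk_symmetric (with_proj H)\<^esub> j" "j \<rightarrow>\<^sup>*\<^bsub>mk_symmetric (with_proj H)\<^esub> i"
    if "(i, j) \<in> parcs H" for i j
    using sym[OF that] by (simp_all add: S.reachable_adjI)
  have reach: "1 \<rightarrow>\<^sup>*\<^bsub>mk_symmetric (with_proj H)\<^esub> j \<and> j \<rightarrow>\<^sup>*\<^bsub>mk_symmetric (with_proj H)\<^esub> 1"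
    if "j \<in> pverts H" for j
    using that
  proof (induction j rule: less_induct)
    case (less j)
    show ?case
    proof (cases "j = 1")
      case True
      then show ?thesis using one by (auto intro: S.reachable_refl)
    next
      case False
      with inc less.prems obtain i where i: "(i, j) \<in> parcs H" by blast
      then have "i < j" "i \<in> pverts H" using assms(3) in_arcsD1 by auto
      with less.IH arc[OF i] show ?thesis by (blast intro: S.reachable_trans)
    qed
  qed
  show ?thesis
    unfolding connected_def
  proof (rule strongly_connectedI)
    show "verts (with_proj (mk_symmetric (with_proj H))) \<noteq> {}" using one by auto
  next
    fix u v assume "u \<in> verts (with_proj (mk_symmetric (with_proj H)))"
      "v \<in> verts (with_proj (mk_symmetric (with_proj H)))"
    then show "u \<rightarrow>\<^sup>*\<^bsub>with_proj (mk_symmetric (with_proj H))\<^esub> v"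
      using reach[of u] reach[of v] by (auto intro: S.reachable_trans)
  qed
qed

section \<open>Netflow and circulations\<close>

lemma parcs_complete_dag [simp]:
  "parcs (complete_dag n) = {(i, j). 1 \<le> i \<and> i < j \<and> j \<le> n + 1}"
  by (simp add: complete_dag_def)

lemma finite_parcs_complete_dag: "finite (parcs (complete_dag n))"
  by (rule finite_subset[of _ "{1..n+1} \<times> {1..n+1}"]) auto

lemma lookup_scaleR [simp]:
  "Poly_Mapping.lookup (c *\<^sub>R f) k = c *\<^sub>R Poly_Mapping.lookup f k"
proof -
  have "finite {i. c *\<^sub>R Poly_Mapping.lookup f i \<noteq> 0}"
    by (rule finite_subset[OF _ finite_keys[of f]]) (auto simp: in_keys_iff)
  then show ?thesis by (simp add: scaleR_poly_mapping_def)
qed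

lemma netflow_add [simp]: "netflow n (f + g) i = netflow n f i + netflow n g i"
  by (simp add: netflow_def lookup_add sum.distrib)

lemma netflow_diff [simp]: "netflow n (f - g) i = netflow n f i - netflow n g i"
  by (simp add: netflow_def lookup_minus sum_subtractf)

lemma netflow_scaleR [simp]: "netflow n (c *\<^sub>R f) i = c * netflow n f i"
  by (simp add: netflow_def sum_distrib_left right_diff_distrib)

lemma netflow_0 [simp]: "netflow n 0 i = 0"
  by (simp add: netflow_def)

lemma netflow_single:
  assumes "(a, b) \<in> parcs (complete_dag n)" "i \<in> {1..n}"
  shows "netflow n (Poly_Mapping.single (a, b) c) i =
    (if i = a then c else 0) - (if i = b then c else 0)"
proof -
  have "(\<Sum>j\<in>{i<..n+1}. Poly_Mapping.lookup (Poly_Mapping.single (a, b) c) (i, j)) =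
      (\<Sum>j\<in>{i<..n+1}. if j = b then (if i = a then c else 0) else 0)"
    by (rule sum.cong) (auto simp: lookup_single when_def)
  moreover have "(\<Sum>k\<in>{1..<i}. Poly_Mapping.lookup (Poly_Mapping.single (a, b) c) (k, i)) =
      (\<Sum>k\<in>{1..<i}. if k = a then (if i = b then c else 0) else 0)"
    by (rule sum.cong) (auto simp: lookup_single when_def)
  ultimately show ?thesis
    using assms by (auto simp: netflow_def)
qed

text \<open>Terms off the support vanish, so the two ordered index ranges can be replaced by one
  common set \<open>V\<close>. This symmetric form is what exchanging double sums and reindexing
  along a bijection require.\<close>

lemma netflow_eq_sum_vertices:
  assumes "Poly_Mapping.keys f \<subseteq> parcs (complete_dag n)" "{1..n+1} \<supseteq> V"
    "Poly_Mapping.keys f \<subseteq> V \<times> V"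
  shows "netflow n f i =
    (\<Sum>j\<in>V. Poly_Mapping.lookup f (i, j)) - (\<Sum>k\<in>V. Poly_Mapping.lookup f (k, i))"
proof -
  have fin: "finite V" using assms(2) by (rule finite_subset) simp
  have zero: "Poly_Mapping.lookup f (a, b) = 0" if "\<not> (1 \<le> a \<and> a < b \<and> b \<le> n + 1 \<and> a \<in> V \<and> b \<in> V)" for a b
    using assms that by (auto simp: in_keys_iff)
  have "(\<Sum>j\<in>{i<..n+1}. Poly_Mapping.lookup f (i, j)) = (\<Sum>j\<in>{i<..n+1} \<inter> V. Poly_Mapping.lookup f (i, j))"
    by (rule sum.mono_neutral_right) (auto intro: zero)
  also have "\<dots> = (\<Sum>j\<in>V. Poly_Mapping.lookup f (i, j))"
    by (rule sum.mono_neutral_left) (auto intro: zero fin)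
  finally have 1: "(\<Sum>j\<in>{i<..n+1}. Poly_Mapping.lookup f (i, j)) = \<dots>" .
  have "(\<Sum>j\<in>{1..<i}. Poly_Mapping.lookup f (j, i)) = (\<Sum>j\<in>{1..<i} \<inter> V. Poly_Mapping.lookup f (j, i))"
    by (rule sum.mono_neutral_right) (auto intro: zero)
  also have "\<dots> = (\<Sum>j\<in>V. Poly_Mapping.lookup f (j, i))"
    by (rule sum.mono_neutral_left) (auto intro: zero fin)
  finally show ?thesis using 1 by (simp add: netflow_def)
qed

text \<open>Summation by parts: the netflow is dual to the coboundary of a potential.\<close>

lemma sum_netflow_scaleR:
  fixes \<phi> :: "nat \<Rightarrow> 'a::real_vector"
  assumes "Poly_Mapping.keys f \<subseteq> parcs (complete_dag n)"
  shows "(\<Sum>e\<in>parcs (complete_dag n). Poly_Mapping.lookup f e *\<^sub>R (\<phi> (fst e) - \<phi> (snd e))) =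
    (\<Sum>i\<in>{1..n+1}. netflow n f i *\<^sub>R \<phi> i)"
proof -
  let ?V = "{1..n+1}" and ?f = "Poly_Mapping.lookup f"
  have "(\<Sum>e\<in>parcs (complete_dag n). ?f e *\<^sub>R (\<phi> (fst e) - \<phi> (snd e))) =
      (\<Sum>e\<in>?V\<times>?V. ?f e *\<^sub>R (\<phi> (fst e) - \<phi> (snd e)))"
  proof (rule sum.mono_neutral_left)
    show "\<forall>e\<in>?V\<times>?V - parcs (complete_dag n). ?f e *\<^sub>R (\<phi> (fst e) - \<phi> (snd e)) = 0"
      using assms by (metis DiffD2 in_keys_iff scaleR_zero_left subsetD)
  qed auto
  also have "\<dots> = (\<Sum>i\<in>?V. \<Sum>j\<in>?V. ?f (i, j) *\<^sub>R \<phi> i) - (\<Sum>i\<in>?V. \<Sum>j\<in>?V. ?f (i, j) *\<^sub>R \<phi> j)"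
    by (simp only: sum.cartesian_product sum_subtractf[symmetric])
      (simp add: case_prod_unfold scaleR_diff_right)
  also have "(\<Sum>i\<in>?V. \<Sum>j\<in>?V. ?f (i, j) *\<^sub>R \<phi> j) = (\<Sum>i\<in>?V. \<Sum>j\<in>?V. ?f (j, i) *\<^sub>R \<phi> i)"
    by (rule sum.swap)
  also have "(\<Sum>i\<in>?V. \<Sum>j\<in>?V. ?f (i, j) *\<^sub>R \<phi> i) - \<dots> =
      (\<Sum>i\<in>?V. ((\<Sum>j\<in>?V. ?f (i, j)) - (\<Sum>j\<in>?V. ?f (j, i))) *\<^sub>R \<phi> i)"
    by (simp only: sum_subtractf[symmetric] scaleR_diff_left scaleR_sum_left)
  also have "\<dots> = (\<Sum>i\<in>{1..n+1}. netflow n f i *\<^sub>R \<phi> i)"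
  proof (rule sum.cong)
    fix i
    have "netflow n f i = (\<Sum>j\<in>?V. ?f (i, j)) - (\<Sum>j\<in>?V. ?f (j, i))"
      using assms by (intro netflow_eq_sum_vertices) auto
    then show "((\<Sum>j\<in>?V. ?f (i, j)) - (\<Sum>j\<in>?V. ?f (j, i))) *\<^sub>R \<phi> i = netflow n f i *\<^sub>R \<phi> i" by simp
  qed simp
  finally show ?thesis .
qed

section \<open>Circulations and the fundamental cycles of a spanning tree\<close>

definition circulations :: "nat \<Rightarrow> (nat \<times> nat) set \<Rightarrow> (nat \<times> nat \<Rightarrow>\<^sub>0 real) set" where
  "circulations n E = {z. Poly_Mapping.keys z \<subseteq> E \<and> (\<forall>i\<in>{1..n}. netflow n z i = 0)}"

text \<open>The unit flow along the parent chain from the root down to \<open>v\<close>. The guard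
  \<open>p v < v\<close> gives termination for every \<open>p\<close>; the root is a fixed point of
  \<open>p\<close>, which ends the chain with the zero flow.\<close>

function tree_path :: "(nat \<Rightarrow> nat) \<Rightarrow> nat \<Rightarrow> (nat \<times> nat \<Rightarrow>\<^sub>0 real)" where
  "tree_path p v = (if p v < v then tree_path p (p v) + Poly_Mapping.single (p v, v) 1 else 0)"
  by auto
termination by (relation "Wellfounded.measure snd") auto

declare tree_path.simps [simp del]

lemma keys_tree_path: "Poly_Mapping.keys (tree_path p v) \<subseteq> {(p w, w) | w. p w < w}"
proof (induction v rule: less_induct)
  case (less v)
  show ?case
  proof (cases "p v < v")
    case True
    then have "Poly_Mapping.keys (tree_path p v) \<subseteq> Poly_Mapping.keys (tree_path p (p v)) \<union> {(p v, v)}"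
      using keys_add[of "tree_path p (p v)" "Poly_Mapping.single (p v, v) 1"]
      by (simp add: tree_path.simps[of p v])
    with less[OF True] True show ?thesis by auto
  qed (simp add: tree_path.simps)
qed

text \<open>A spanning tree of \<open>E\<close> rooted at 1, given by the parent map \<open>p\<close> (a fixed point off the
  non-root vertices).\<close>

locale flow_tree =
  fixes n :: nat and E :: "(nat \<times> nat) set" and p :: "nat \<Rightarrow> nat"
  assumes E: "E \<subseteq> parcs (complete_dag n)"
    and root: "1 \<in> edge_verts E"
    and parent: "\<And>v. v \<in> edge_verts E \<Longrightarrow> v \<noteq> 1 \<Longrightarrow> (p v, v) \<in> E"
    and parent_fix: "\<And>v. v \<notin> edge_verts E - {1} \<Longrightarrow> p v = v"
begin

lemma finite_E: "finite E"
  using E finite_parcs_complete_dag by (rule finite_subset)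

lemma finite_verts: "finite (edge_verts E)"
  using finite_E by (simp add: edge_verts_def)

lemma parent_less: "p v < v \<longleftrightarrow> v \<in> edge_verts E \<and> v \<noteq> 1"
proof
  show "v \<in> edge_verts E \<and> v \<noteq> 1 \<Longrightarrow> p v < v" using parent[of v] E by auto
  show "p v < v \<Longrightarrow> v \<in> edge_verts E \<and> v \<noteq> 1" using parent_fix[of v] by auto
qed

definition tree_arcs :: "(nat \<times> nat) set" where
  "tree_arcs = (\<lambda>v. (p v, v)) ` (edge_verts E - {1})"

lemma tree_arcs_subset: "tree_arcs \<subseteq> E"
  using parent by (auto simp: tree_arcs_def)

lemma card_tree_arcs: "card tree_arcs + 1 = card (edge_verts E)"
proof -
  have "card tree_arcs = card (edge_verts E - {1})"
    unfolding tree_arcs_def by (rule card_image) (auto simp: inj_on_def)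
  then show ?thesis using root finite_verts by (metis Suc_eq_plus1 card_Suc_Diff1)
qed

lemma keys_tree_path_subset: "Poly_Mapping.keys (tree_path p v) \<subseteq> tree_arcs"
  using keys_tree_path[of p v] by (auto simp: tree_arcs_def parent_less)

text \<open>Contributions at intermediate vertices cancel along the recursion. For
  \<open>v = 1\<close> the two indicators cancel, and for \<open>v = n + 1\<close> the second one
  never fires because \<open>i \<le> n\<close>.\<close>

lemma netflow_tree_path:
  assumes "v \<in> edge_verts E" "i \<in> {1..n}"
  shows "netflow n (tree_path p v) i = (if i = 1 then 1 else 0) - (if i = v then 1 else 0)"
  using assms(1)
proof (induction v rule: less_induct)
  case (less v)
  show ?case
  proof (cases "v = 1")
    case True
    then show ?thesis using parent_less[of v] by (simp add: tree_path.simps)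
  next
    case False
    then have e: "(p v, v) \<in> E" and lt: "p v < v" using parent less.prems parent_less by auto
    from e have "p v \<in> edge_verts E" by (force simp: edge_verts_def)
    moreover have "(p v, v) \<in> parcs (complete_dag n)" using e E by blast
    ultimately show ?thesis
      using less.IH[OF lt] netflow_single[OF _ assms(2), of "p v" v 1] lt
      by (simp add: tree_path.simps[of p v])
  qed
qed

text \<open>Go from the root to the tail of \<open>e\<close>, cross \<open>e\<close>, and return
  along the tree path of its head. The shared initial stretch of the two paths cancels.\<close>

definition fundamental_cycle :: "nat \<times> nat \<Rightarrow> (nat \<times> nat \<Rightarrow>\<^sub>0 real)" where
  "fundamental_cycle e = tree_path p (fst e) + Poly_Mapping.single e 1 - tree_path p (snd e)"

lemma fundamental_cycle_tree:
  assumes "e \<in> tree_arcs"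
  shows "fundamental_cycle e = 0"
proof -
  obtain v where e: "e = (p v, v)" and "p v < v"
    using assms parent_less by (auto simp: tree_arcs_def)
  then have "tree_path p v = tree_path p (p v) + Poly_Mapping.single (p v, v) 1"
    by (simp only: tree_path.simps[of p v] if_True)
  then show ?thesis
    unfolding fundamental_cycle_def e fst_conv snd_conv by (simp only: diff_self)
qed

lemma fundamental_cycle_in_circulations:
  assumes "e \<in> E"
  shows "fundamental_cycle e \<in> circulations n E"
proof -
  obtain a b where e: "e = (a, b)" by force
  have ab: "a \<in> edge_verts E" "b \<in> edge_verts E" using assms by (force simp: e edge_verts_def)+
  have "Poly_Mapping.keys (fundamental_cycle e) \<subseteq> E"
    using keys_diff[of "tree_path p a + Poly_Mapping.single e 1" "tree_path p b"]
      keys_add[of "tree_path p a" "Poly_Mapping.single e (1::real)"]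
      keys_tree_path_subset[of a] keys_tree_path_subset[of b] tree_arcs_subset assms
    by (simp add: fundamental_cycle_def e) blast
  moreover have "netflow n (fundamental_cycle e) i = 0" if "i \<in> {1..n}" for i
  proof -
    have "(a, b) \<in> parcs (complete_dag n)" using assms E e by blast
    then show ?thesis
      using netflow_single[OF _ that, of a b 1] netflow_tree_path[OF ab(1) that]
        netflow_tree_path[OF ab(2) that]
      by (simp add: fundamental_cycle_def e)
  qed
  ultimately show ?thesis by (simp add: circulations_def)
qed

text \<open>Tree paths use tree arcs only. The non-tree coordinates thus form a dual system to the
  fundamental cycles, from which injectivity and independence follow.\<close>

lemma lookup_fundamental_cycle:
  assumes "e' \<notin> tree_arcs"
  shows "Poly_Mapping.lookup (fundamental_cycle e) e' = (if e = e' then 1 else 0)"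
proof -
  have "Poly_Mapping.lookup (tree_path p v) e' = 0" for v
    using keys_tree_path_subset[of v] assms by (auto simp: in_keys_iff)
  then show ?thesis
    by (simp add: fundamental_cycle_def lookup_add lookup_minus lookup_single when_def)
qed

text \<open>Write \<open>z\<close> as a combination of single edges and replace each edge by its
  fundamental cycle. The correction is the weighted sum of path differences, which vanishes by
  duality, and tree arcs contribute nothing.\<close>

lemma circulation_eq_sum:
  assumes "z \<in> circulations n E"
  shows "z = (\<Sum>e\<in>E - tree_arcs. Poly_Mapping.lookup z e *\<^sub>R fundamental_cycle e)"
proof -
  let ?K = "parcs (complete_dag n)" and ?z = "Poly_Mapping.lookup z"
  have keys: "Poly_Mapping.keys z \<subseteq> E" and zero: "\<And>i. i \<in> {1..n} \<Longrightarrow> netflow n z i = 0"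
    using assms by (auto simp: circulations_def)
  have keysK: "Poly_Mapping.keys z \<subseteq> ?K" using keys E by blast
  have sum_eq: "(\<Sum>i\<in>{1..n+1}. netflow n z i *\<^sub>R \<phi> i) = netflow n z (n+1) *\<^sub>R \<phi> (n+1)"
    for \<phi> :: "nat \<Rightarrow> 'b::real_vector"
    using zero by simp
  \<comment> \<open>Conservation at the sink is not part of \<open>circulations\<close>; the
    constant potential 1 supplies it, since its coboundary is zero.\<close>
  have "netflow n z (n+1) *\<^sub>R (1::real) = 0"
    using sum_netflow_scaleR[OF keysK, of "\<lambda>_. 1::real"] sum_eq[of "\<lambda>_. 1::real"] by simp
  \<comment> \<open>Here the potential is vector valued: vertex \<open>v\<close> receives the flow
    \<open>tree_path p v\<close>.\<close>
  then have boundary: "(\<Sum>e\<in>?K. ?z e *\<^sub>R (tree_path p (fst e) - tree_path p (snd e))) = 0"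
    using sum_netflow_scaleR[OF keysK, of "tree_path p"] sum_eq[of "tree_path p"] by simp
  have single: "z = (\<Sum>e\<in>?K. ?z e *\<^sub>R Poly_Mapping.single e 1)"
  proof (rule poly_mapping_eqI)
    fix k
    have "(\<Sum>e\<in>?K. ?z e *\<^sub>R (1 when e = k)) = (\<Sum>e\<in>?K. if e = k then ?z e else 0)"
      by (rule sum.cong) (auto simp: when_def)
    also have "\<dots> = (if k \<in> ?K then ?z k else 0)"
      using finite_parcs_complete_dag[of n] by (rule sum.delta)
    also have "\<dots> = ?z k" using keysK by (auto simp: in_keys_iff)
    finally show "?z k = Poly_Mapping.lookup (\<Sum>e\<in>?K. ?z e *\<^sub>R Poly_Mapping.single e 1) k"
      by (simp only: lookup_sum lookup_scaleR lookup_single)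
  qed
  have "z = (\<Sum>e\<in>?K. ?z e *\<^sub>R Poly_Mapping.single e 1) +
      (\<Sum>e\<in>?K. ?z e *\<^sub>R (tree_path p (fst e) - tree_path p (snd e)))"
    using single boundary by simp
  also have "\<dots> = (\<Sum>e\<in>?K. ?z e *\<^sub>R fundamental_cycle e)"
    by (simp only: sum.distrib[symmetric]) (simp add: fundamental_cycle_def algebra_simps)
  also have "\<dots> = (\<Sum>e\<in>E - tree_arcs. ?z e *\<^sub>R fundamental_cycle e)"
  proof (rule sum.mono_neutral_right)
    show "\<forall>e\<in>?K - (E - tree_arcs). ?z e *\<^sub>R fundamental_cycle e = 0"
    proof
      fix e assume "e \<in> ?K - (E - tree_arcs)"
      then have "?z e = 0 \<or> e \<in> tree_arcs" using keys by (auto simp: in_keys_iff)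
      then show "?z e *\<^sub>R fundamental_cycle e = 0" using fundamental_cycle_tree[of e] by auto
    qed
  qed (use E finite_parcs_complete_dag in auto)
  finally show ?thesis .
qed

lemma inj_on_fundamental_cycle: "inj_on fundamental_cycle (E - tree_arcs)"
proof (rule inj_onI)
  fix e e' assume "e \<in> E - tree_arcs" "e' \<in> E - tree_arcs" and eq: "fundamental_cycle e = fundamental_cycle e'"
  then have "Poly_Mapping.lookup (fundamental_cycle e') e = 1"
    using lookup_fundamental_cycle[of e e] by simp
  then show "e = e'"
    using lookup_fundamental_cycle[of e e'] \<open>e \<in> E - tree_arcs\<close> by (simp split: if_splits)
qed

lemma independent_fundamental_cycles: "independent (fundamental_cycle ` (E - tree_arcs))"
proof (rule independent_if_scalars_zero)
  fix c x
  assume sum: "(\<Sum>x\<in>fundamental_cycle ` (E - tree_arcs). c x *\<^sub>R x) = 0"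
    and "x \<in> fundamental_cycle ` (E - tree_arcs)"
  then obtain e' where e': "e' \<in> E - tree_arcs" "x = fundamental_cycle e'" by blast
  \<comment> \<open>Reading off coordinate \<open>e'\<close> isolates the coefficient of its own
    cycle.\<close>
  have "Poly_Mapping.lookup (\<Sum>e\<in>E - tree_arcs. c (fundamental_cycle e) *\<^sub>R fundamental_cycle e) e' =
      (\<Sum>e\<in>E - tree_arcs. if e = e' then c (fundamental_cycle e) else 0)"
    unfolding lookup_sum using e' by (intro sum.cong) (auto simp: lookup_fundamental_cycle)
  also have "\<dots> = c x" using e' finite_E by simp
  finally show "c x = 0"
    using sum unfolding sum.reindex[OF inj_on_fundamental_cycle] o_def by simp
qed (use finite_E in simp)

lemma span_fundamental_cycles:
  "span (fundamental_cycle ` (E - tree_arcs)) = span (circulations n E)" (is "span ?B = _")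
proof -
  have "?B \<subseteq> span (circulations n E)"
    using fundamental_cycle_in_circulations by (auto intro: span_base)
  moreover have "z \<in> span ?B" if "z \<in> circulations n E" for z
  proof -
    have "(\<Sum>e\<in>E - tree_arcs. Poly_Mapping.lookup z e *\<^sub>R fundamental_cycle e) \<in> span ?B"
      by (rule span_sum, rule span_scale, rule span_base, rule imageI)
    then show ?thesis
      by (simp only: circulation_eq_sum[OF that, symmetric])
  qed
  ultimately show ?thesis by (simp add: span_eq subset_iff)
qed

text \<open>The basis has one cycle per non-tree edge, and the tree has one arc fewer than there are
  vertices. The additive form avoids truncated subtraction.\<close>

lemma dim_circulations: "dim (circulations n E) + card (edge_verts E) = card E + 1"
proof -
  have dim: "dim (circulations n E) = card (E - tree_arcs)"
    using dim_eq_card[OF span_fundamental_cycles independent_fundamental_cycles]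
    by (simp only: card_image[OF inj_on_fundamental_cycle])
  have "card (E - tree_arcs) = card E - card tree_arcs"
    by (rule card_Diff_subset[OF finite_subset[OF tree_arcs_subset finite_E] tree_arcs_subset])
  moreover have "card tree_arcs \<le> card E"
    by (rule card_mono[OF finite_E tree_arcs_subset])
  ultimately have "card (E - tree_arcs) + card (edge_verts E) = card E + 1"
    unfolding card_tree_arcs[symmetric] by simp
  then show ?thesis unfolding dim .
qed

end

section \<open>Faces of the flow polytope\<close>

lemma unit_flow_nonneg:
  assumes "unit_flow n f"
  shows "0 \<le> Poly_Mapping.lookup f e"
proof (cases "e \<in> Poly_Mapping.keys f")
  case True
  then have "e \<in> parcs (complete_dag n)" using assms unfolding unit_flow_def by blast
  then show ?thesis using assms unfolding unit_flow_def by blast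
qed (simp add: in_keys_iff)

lemma unit_flow_pos:
  assumes "unit_flow n f" "e \<in> Poly_Mapping.keys f"
  shows "0 < Poly_Mapping.lookup f e"
  using unit_flow_nonneg[OF assms(1), of e] assms(2) by (simp add: in_keys_iff)

lemma CRY_iff_unit_flow [simp]: "f \<in> CRY n \<longleftrightarrow> unit_flow n f"
  by (simp add: CRY_def)

lemma unit_flow_segment:
  assumes "unit_flow n f" "unit_flow n g" "0 \<le> u" "u \<le> 1"
  shows "unit_flow n ((1 - u) *\<^sub>R f + u *\<^sub>R g)"
proof -
  have "Poly_Mapping.keys ((1 - u) *\<^sub>R f + u *\<^sub>R g) \<subseteq> Poly_Mapping.keys f \<union> Poly_Mapping.keys g"
    by (auto simp: in_keys_iff lookup_add)
  moreover have "0 \<le> Poly_Mapping.lookup ((1 - u) *\<^sub>R f + u *\<^sub>R g) e" for e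
    using assms unit_flow_nonneg by (simp add: lookup_add)
  ultimately show ?thesis
    using assms unfolding unit_flow_def by (auto simp: algebra_simps)
qed

text \<open>Nonnegative values with positive weights cannot cancel.\<close>

lemma keys_segment:
  assumes "unit_flow n f" "unit_flow n g" "0 < u" "u < 1"
  shows "Poly_Mapping.keys ((1 - u) *\<^sub>R f + u *\<^sub>R g) = Poly_Mapping.keys f \<union> Poly_Mapping.keys g"
proof -
  have "(1 - u) * Poly_Mapping.lookup f e + u * Poly_Mapping.lookup g e = 0 \<longleftrightarrow>
      Poly_Mapping.lookup f e = 0 \<and> Poly_Mapping.lookup g e = 0" for e
    using assms unit_flow_nonneg[OF assms(1), of e] unit_flow_nonneg[OF assms(2), of e]
    by (simp add: add_nonneg_eq_0_iff)
  then show ?thesis by (auto simp: in_keys_iff lookup_add)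
qed

section \<open>Supports of unit flows and the vertices they meet\<close>

definition flow_support :: "nat \<Rightarrow> (nat \<times> nat) set \<Rightarrow> bool" where
  "flow_support n E \<longleftrightarrow> (\<exists>f. unit_flow n f \<and> Poly_Mapping.keys f = E)"

definition support_face :: "nat \<Rightarrow> (nat \<times> nat) set \<Rightarrow> (nat \<times> nat \<Rightarrow>\<^sub>0 real) set" where
  "support_face n E = {f \<in> CRY n. Poly_Mapping.keys f \<subseteq> E}"

lemma flow_support_subset: "flow_support n E \<Longrightarrow> E \<subseteq> parcs (complete_dag n)"
  unfolding flow_support_def unit_flow_def by blast

lemma finite_flow_supports: "finite {E. flow_support n E}"
  by (rule finite_subset[of _ "Pow (parcs (complete_dag n))"])
    (use flow_support_subset finite_parcs_complete_dag in blast)+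

text \<open>Without inflow the total outflow equals the netflow, hence is at most 0; as a sum of
  nonnegative terms it can then have no positive term.\<close>

lemma unit_flow_netflow_zero:
  assumes "unit_flow n f" "v \<in> {1..n}" "netflow n f v \<le> 0" "\<And>u. (u, v) \<notin> Poly_Mapping.keys f"
  shows "(v, w) \<notin> Poly_Mapping.keys f"
proof
  assume vw: "(v, w) \<in> Poly_Mapping.keys f"
  then have w: "w \<in> {v<..n+1}" using assms(1) by (auto simp: unit_flow_def)
  have "(\<Sum>k\<in>{1..<v}. Poly_Mapping.lookup f (k, v)) = 0"
    using assms(4) by (simp add: in_keys_iff)
  then have "(\<Sum>j\<in>{v<..n+1}. Poly_Mapping.lookup f (v, j)) \<le> 0"
    using assms(3) by (simp add: netflow_def)
  moreover have "Poly_Mapping.lookup f (v, w) \<le> (\<Sum>j\<in>{v<..n+1}. Poly_Mapping.lookup f (v, j))"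
    using w unit_flow_nonneg[OF assms(1)] by (intro member_le_sum) auto
  ultimately show False using unit_flow_pos[OF assms(1) vw] by simp
qed

lemma flow_support_incoming:
  assumes "flow_support n E" "v \<in> edge_verts E" "v \<noteq> 1"
  shows "\<exists>u. (u, v) \<in> E"
proof (rule ccontr)
  assume none: "\<nexists>u. (u, v) \<in> E"
  obtain f where f: "unit_flow n f" "Poly_Mapping.keys f = E" using assms(1) by (auto simp: flow_support_def)
  from none assms(2) obtain w where w: "(v, w) \<in> E" by (auto simp: edge_verts_def)
  \<comment> \<open>The outgoing edge excludes the sink, so conservation is available at
    \<open>v\<close>.\<close>
  then have v: "v \<in> {1..n}" using flow_support_subset[OF assms(1)] by auto
  then have "netflow n f v = 0" using f assms(3) by (simp add: unit_flow_def)
  then show False using unit_flow_netflow_zero[OF f(1) v, of w] none w f(2) by auto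
qed

lemma flow_support_outgoing:
  assumes "flow_support n E" "v \<in> edge_verts E" "v \<noteq> n + 1"
  shows "\<exists>w. (v, w) \<in> E"
proof (rule ccontr)
  assume none: "\<nexists>w. (v, w) \<in> E"
  obtain f where f: "unit_flow n f" "Poly_Mapping.keys f = E" using assms(1) by (auto simp: flow_support_def)
  from none assms(2) obtain u where u: "(u, v) \<in> E" by (auto simp: edge_verts_def)
  then have v: "v \<in> {1..n}" "u \<in> {1..<v}" using flow_support_subset[OF assms(1)] assms(3) by auto
  have "(\<Sum>j\<in>{v<..n+1}. Poly_Mapping.lookup f (v, j)) = 0"
    using none unfolding f(2)[symmetric] by (simp add: in_keys_iff)
  \<comment> \<open>The netflow is 1 at the source and 0 at inner vertices; in either case the
    inflow is bounded by the vanishing outflow.\<close>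
  moreover have "netflow n f v \<ge> 0" using f v by (simp add: unit_flow_def)
  moreover have "Poly_Mapping.lookup f (u, v) \<le> (\<Sum>k\<in>{1..<v}. Poly_Mapping.lookup f (k, v))"
    using v unit_flow_nonneg[OF f(1)] by (intro member_le_sum[of u]) auto
  ultimately show False using unit_flow_pos[OF f(1), of "(u, v)"] u f(2) by (simp add: netflow_def)
qed

lemma flow_support_source:
  assumes "flow_support n E" "n \<ge> 1"
  shows "1 \<in> edge_verts E"
proof -
  obtain f where f: "unit_flow n f" "Poly_Mapping.keys f = E" using assms(1) by (auto simp: flow_support_def)
  then have "netflow n f 1 = 1" using assms(2) by (simp add: unit_flow_def)
  then have "(\<Sum>j\<in>{1<..n+1}. Poly_Mapping.lookup f (1, j)) \<noteq> 0" by (simp add: netflow_def)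
  then obtain j where "Poly_Mapping.lookup f (1, j) \<noteq> 0" by (meson sum.neutral)
  then have "(1, j) \<in> E" unfolding f(2)[symmetric] by (simp add: in_keys_iff)
  then show ?thesis by (force simp: edge_verts_def)
qed

lemma finite_edge_verts: "finite E \<Longrightarrow> finite (edge_verts E)"
  by (simp add: edge_verts_def)

lemma finite_flow_support: "flow_support n E \<Longrightarrow> finite E"
  using flow_support_subset finite_parcs_complete_dag finite_subset by blast

text \<open>Otherwise the largest vertex of the support would have an outgoing edge, leading to a
  still larger vertex of the support.\<close>

lemma flow_support_sink:
  assumes "flow_support n E" "n \<ge> 1"
  shows "n + 1 \<in> edge_verts E"
proof (rule ccontr)
  assume no: "n + 1 \<notin> edge_verts E"
  define m where "m = Max (edge_verts E)"
  have fin: "finite (edge_verts E)" using assms finite_flow_support finite_edge_verts by blast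
  then have "m \<in> edge_verts E" using flow_support_source[OF assms] unfolding m_def by (intro Max_in) auto
  moreover from this no have "m \<noteq> n + 1" by auto
  ultimately obtain w where w: "(m, w) \<in> E" using flow_support_outgoing[OF assms(1)] by blast
  then have "w \<in> edge_verts E" by (force simp: edge_verts_def)
  then have "w \<le> m" using fin by (simp add: m_def)
  moreover have "m < w" using w flow_support_subset[OF assms(1)] by auto
  ultimately show False by simp
qed

lemma flow_support_verts:
  assumes "flow_support n E"
  shows "edge_verts E \<subseteq> {1..n+1}"
  using flow_support_subset[OF assms] by (fastforce simp: edge_verts_def)

section \<open>Dimension and classification of the nonempty faces\<close>

lemma unit_flow_perturb:
  assumes f: "unit_flow n f" and z: "z \<in> circulations n (Poly_Mapping.keys f)"
  shows "\<exists>\<epsilon>>0. f + \<epsilon> *\<^sub>R z \<in> support_face n (Poly_Mapping.keys f)"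
proof -
  let ?E = "Poly_Mapping.keys f" and ?f = "Poly_Mapping.lookup f" and ?z = "Poly_Mapping.lookup z"
  \<comment> \<open>On a support edge, \<open>\<epsilon>\<close> times the absolute value of
    \<open>z\<close> stays below the flow value, so the sum stays nonnegative; off the support both
    flows vanish. The 1 in the denominator prevents division by zero, and the inserted 1 keeps the
    set nonempty.\<close>
  define \<epsilon> where "\<epsilon> = Min (insert 1 ((\<lambda>e. ?f e / (\<bar>?z e\<bar> + 1)) ` ?E))"
  have pos: "\<epsilon> > 0"
    unfolding \<epsilon>_def using unit_flow_pos[OF f] by (subst Min_gr_iff) auto
  have "0 \<le> ?f e + \<epsilon> * ?z e" for e
  proof (cases "e \<in> ?E")
    case True
    then have "\<epsilon> \<le> ?f e / (\<bar>?z e\<bar> + 1)" unfolding \<epsilon>_def by (intro Min_le) auto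
    then have "\<epsilon> * (\<bar>?z e\<bar> + 1) \<le> ?f e" by (simp add: field_simps)
    moreover have "\<epsilon> * (- ?z e) \<le> \<epsilon> * (\<bar>?z e\<bar> + 1)" using pos by (intro mult_left_mono) auto
    ultimately show ?thesis by simp
  next
    case False
    then have "e \<notin> Poly_Mapping.keys z" using z by (auto simp: circulations_def)
    with False show ?thesis by (simp add: in_keys_iff)
  qed
  moreover have "Poly_Mapping.keys (f + \<epsilon> *\<^sub>R z) \<subseteq> ?E"
    using z by (auto simp: in_keys_iff lookup_add circulations_def subset_iff)
  ultimately have "f + \<epsilon> *\<^sub>R z \<in> support_face n ?E"
    using f z by (auto simp: support_face_def unit_flow_def circulations_def lookup_add)
  with pos show ?thesis by blast
qed

text \<open>Differences of members are circulations on \<open>E\<close>. Conversely, a flow with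
  support exactly \<open>E\<close> can be shifted by a small multiple of any circulation on
  \<open>E\<close> within the face, so each circulation is a multiple of such a difference.\<close>

lemma affine_dim_support_face:
  assumes "n \<ge> 1" "flow_support n E"
  shows "affine_dim (support_face n E) = int (card E) - int (card (edge_verts E)) + 1"
proof -
  obtain f where f: "unit_flow n f" "Poly_Mapping.keys f = E"
    using assms(2) by (auto simp: flow_support_def)
  have fF: "f \<in> support_face n E" using f by (simp add: support_face_def)
  \<comment> \<open>Any incoming edge serves as the tree edge of \<open>v\<close>.\<close>
  define p where "p v = (if v \<in> edge_verts E - {1} then SOME u. (u, v) \<in> E else v)" for v
  have "flow_tree n E p"
  proof
    show "E \<subseteq> parcs (complete_dag n)" by (rule flow_support_subset[OF assms(2)])
    show "1 \<in> edge_verts E" by (rule flow_support_source[OF assms(2,1)])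
    show "(p v, v) \<in> E" if "v \<in> edge_verts E" "v \<noteq> 1" for v
      using someI_ex[OF flow_support_incoming[OF assms(2) that]] that by (simp add: p_def)
    show "p v = v" if "v \<notin> edge_verts E - {1}" for v
      using that by (simp only: p_def if_False)
  qed
  then interpret flow_tree n E p .
  let ?D = "{x - y | x y. x \<in> support_face n E \<and> y \<in> support_face n E}"
  have "?D \<subseteq> circulations n E"
  proof
    fix z assume "z \<in> ?D"
    then obtain x y where z: "z = x - y" and xy: "x \<in> support_face n E" "y \<in> support_face n E" by blast
    then have "Poly_Mapping.keys z \<subseteq> E" using keys_diff[of x y] by (auto simp: support_face_def)
    moreover have "netflow n z i = 0" if "i \<in> {1..n}" for i
      using xy that by (simp add: z support_face_def unit_flow_def)
    ultimately show "z \<in> circulations n E" by (simp add: circulations_def)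
  qed
  moreover have "circulations n E \<subseteq> span ?D"
  proof
    fix z assume "z \<in> circulations n E"
    then obtain \<epsilon> where \<epsilon>: "\<epsilon> > 0" "f + \<epsilon> *\<^sub>R z \<in> support_face n E"
      using unit_flow_perturb[OF f(1)] f(2) by blast
    have "(1 / \<epsilon>) *\<^sub>R ((f + \<epsilon> *\<^sub>R z) - f) \<in> span ?D"
      using \<epsilon>(2) fF by (intro span_scale span_base) blast
    then show "z \<in> span ?D" using \<epsilon>(1) by simp
  qed
  ultimately have "span ?D = span (circulations n E)"
    using span_base by (subst span_eq) blast
  then have "dim (span ?D) = dim (span (circulations n E))" by (rule arg_cong)
  then have "dim ?D = dim (circulations n E)" by (simp only: dim_span)
  moreover have "affine_dim (support_face n E) = int (dim ?D)"
    unfolding affine_dim_def using fF by (intro if_not_P) blast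
  ultimately show ?thesis using dim_circulations by linarith
qed

text \<open>An inner point of a segment carries the supports of both endpoints; if it is supported
  in \<open>E\<close>, so are they.\<close>

lemma support_face_face_of: "support_face n E face_of CRY n"
  unfolding face_of_def
proof (intro conjI ballI impI)
  show "support_face n E \<subseteq> CRY n" by (auto simp: support_face_def)
  show "convex (support_face n E)"
    unfolding convex_alt
  proof (intro ballI allI impI)
    fix x y and u :: real
    assume xy: "x \<in> support_face n E" "y \<in> support_face n E" and u: "0 \<le> u \<and> u \<le> 1"
    have "Poly_Mapping.keys ((1 - u) *\<^sub>R x + u *\<^sub>R y) \<subseteq> Poly_Mapping.keys x \<union> Poly_Mapping.keys y"
      by (auto simp: in_keys_iff lookup_add)
    with xy u show "(1 - u) *\<^sub>R x + u *\<^sub>R y \<in> support_face n E"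
      using unit_flow_segment[of n x y u] by (auto simp: support_face_def)
  qed
next
  fix a b x
  assume "a \<in> CRY n" "b \<in> CRY n" and x: "x \<in> support_face n E" "x \<in> open_segment a b"
  moreover from x(2) obtain u where "0 < u" "u < 1" "x = (1 - u) *\<^sub>R a + u *\<^sub>R b"
    by (auto simp: in_segment)
  ultimately have "a \<in> support_face n E \<and> b \<in> support_face n E"
    using keys_segment[of n a b u] by (auto simp: support_face_def)
  then show "a \<in> support_face n E" "b \<in> support_face n E" by auto
qed

text \<open>The support of a face is that of a member of maximal support; every other flow with smaller
  support lies in the face because the segment from it through that member can be prolonged.\<close>

lemma face_of_CRY:
  assumes "F face_of CRY n" "F \<noteq> {}"
  shows "\<exists>E. flow_support n E \<and> F = support_face n E"
proof -
  have sub: "F \<subseteq> CRY n" and conv: "convex F"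
    and face: "\<And>a b x. a \<in> CRY n \<Longrightarrow> b \<in> CRY n \<Longrightarrow> x \<in> F \<Longrightarrow> x \<in> open_segment a b \<Longrightarrow> a \<in> F"
    using assms(1) unfolding face_of_def by blast+
  let ?S = "Poly_Mapping.keys ` F"
  have supports: "?S \<subseteq> {E. flow_support n E}" using sub by (auto simp only: flow_support_def CRY_iff_unit_flow image_iff mem_Collect_eq subset_iff)
  then have "finite ?S" using finite_flow_supports finite_subset by blast
  moreover have "?S \<noteq> {}" using assms(2) by blast
  ultimately obtain E where E: "E \<in> ?S" "\<And>E'. E' \<in> ?S \<Longrightarrow> E \<subseteq> E' \<Longrightarrow> E = E'"
    using finite_has_maximal[of ?S] by blast
  then obtain f where f: "f \<in> F" "E = Poly_Mapping.keys f" by blast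
  then have uf: "unit_flow n f" using sub by auto
  have "F = support_face n E"
  proof (intro equalityI subsetI)
    fix g assume g: "g \<in> F"
    then have ug: "unit_flow n g" using sub by auto
    \<comment> \<open>The midpoint carries the union of both supports, so maximality of
      \<open>E\<close> forbids edges of \<open>g\<close> outside \<open>E\<close>.\<close>
    let ?h = "(1 - 1/2) *\<^sub>R f + (1/2) *\<^sub>R g"
    have "?h \<in> F" by (rule convexD_alt[OF conv f(1) g]) simp_all
    moreover have "Poly_Mapping.keys ?h = E \<union> Poly_Mapping.keys g"
      using keys_segment[OF uf ug, of "1/2"] f(2) by simp
    ultimately have "E = E \<union> Poly_Mapping.keys g" using E(2) by blast
    then show "g \<in> support_face n E" using ug by (auto simp: support_face_def)
  next
    fix g assume g: "g \<in> support_face n E"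
    then have ug: "unit_flow n g" "Poly_Mapping.keys g \<subseteq> E" by (auto simp: support_face_def)
    show "g \<in> F"
    proof (cases "g = f")
      case False
      have "f - g \<in> circulations n E"
        using uf ug keys_diff[of f g] f(2) by (auto simp: circulations_def unit_flow_def)
      then obtain \<epsilon> where \<epsilon>: "\<epsilon> > 0" "f + \<epsilon> *\<^sub>R (f - g) \<in> support_face n E"
        using unit_flow_perturb[OF uf] f(2) by blast
      \<comment> \<open>\<open>?h\<close> lies beyond \<open>f\<close> on the ray from
        \<open>g\<close>, and \<open>f\<close> divides the segment from \<open>g\<close> to
        \<open>?h\<close> in the ratio 1 to \<open>\<epsilon>\<close>; this gives \<open>?u\<close>.
        The identity is checked after scaling by \<open>1 + \<epsilon>\<close> to clear
        denominators.\<close>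
      let ?h = "f + \<epsilon> *\<^sub>R (f - g)" and ?u = "1 / (1 + \<epsilon>)"
      have "(1 + \<epsilon>) *\<^sub>R ((1 - ?u) *\<^sub>R g + ?u *\<^sub>R ?h) = (1 + \<epsilon>) *\<^sub>R f"
      proof -
        have "(1 + \<epsilon>) * (1 - ?u) = \<epsilon>" "(1 + \<epsilon>) * ?u = 1" using \<epsilon>(1) by (simp_all add: field_simps)
        then have "(1 + \<epsilon>) *\<^sub>R ((1 - ?u) *\<^sub>R g + ?u *\<^sub>R ?h) = \<epsilon> *\<^sub>R g + ?h"
          by (simp only: scaleR_add_right[of "1 + \<epsilon>" "(1 - ?u) *\<^sub>R g"] scaleR_scaleR) simp
        then show ?thesis by (simp add: algebra_simps)
      qed
      then have f_eq: "f = (1 - ?u) *\<^sub>R g + ?u *\<^sub>R ?h" using \<epsilon>(1) by simp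
      have "g \<noteq> ?h"
      proof
        assume "g = ?h"
        then have "(1 + \<epsilon>) *\<^sub>R (f - g) = 0" by (simp add: algebra_simps)
        then show False using \<epsilon>(1) False by simp
      qed
      then have "f \<in> open_segment g ?h"
        unfolding in_segment using \<epsilon>(1) f_eq by (intro conjI exI[of _ ?u]) auto
      then show ?thesis
        using face[of g ?h f] ug \<epsilon>(2) f(1) by (simp add: support_face_def)
    qed (use f in simp)
  qed
  then show ?thesis using E(1) supports by blast
qed

text \<open>A flow with support exactly \<open>E\<close> lies in the face of \<open>E\<close>, so
  equal faces force inclusion of the supports in both directions.\<close>

lemma inj_on_support_face: "inj_on (support_face n) {E. flow_support n E}"
proof (rule inj_onI)
  have *: "E \<subseteq> E'" if "flow_support n E" "support_face n E = support_face n E'" for E E'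
    using that by (auto simp: flow_support_def support_face_def)
  fix E E' assume "E \<in> {E. flow_support n E}" "E' \<in> {E. flow_support n E}"
    "support_face n E = support_face n E'"
  then show "E = E'" using *[of E E'] *[of E' E] by auto
qed

lemma f_vector_eq_card_supports:
  assumes "n \<ge> 1"
  shows "f_vector n d = card {E. flow_support n E \<and> card E + 1 = card (edge_verts E) + d}"
proof -
  let ?A = "{E. flow_support n E \<and> card E + 1 = card (edge_verts E) + d}"
  have dim: "affine_dim (support_face n E) = int d \<longleftrightarrow> card E + 1 = card (edge_verts E) + d"
    if "flow_support n E" for E
    using affine_dim_support_face[OF assms that] by linarith
  have "{F. F face_of CRY n \<and> affine_dim F = int d} = support_face n ` ?A"
  proof (intro equalityI subsetI)
    fix F assume F: "F \<in> {F. F face_of CRY n \<and> affine_dim F = int d}"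
    then have "F \<noteq> {}" by (auto simp: affine_dim_def)
    then show "F \<in> support_face n ` ?A" using F face_of_CRY[of F n] dim by auto
  next
    fix F assume "F \<in> support_face n ` ?A"
    then show "F \<in> {F. F face_of CRY n \<and> affine_dim F = int d}"
      using support_face_face_of dim by auto
  qed
  moreover have "inj_on (support_face n) ?A"
    using inj_on_support_face by (rule inj_on_subset) auto
  ultimately show ?thesis by (simp add: f_vector_def card_image)
qed

section \<open>Renumbering the vertices of a support\<close>

lemma ex_poly_mapping_of_finite:
  fixes h :: "'a \<Rightarrow> real"
  assumes "finite A"
  shows "\<exists>f. Poly_Mapping.lookup f = (\<lambda>k. if k \<in> A then h k else 0)"
proof
  have "finite {k. (if k \<in> A then h k else 0) \<noteq> 0}"
    by (rule finite_subset[OF _ assms]) auto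
  then show "Poly_Mapping.lookup (Abs_poly_mapping (\<lambda>k. if k \<in> A then h k else 0)) =
      (\<lambda>k. if k \<in> A then h k else 0)"
    by simp
qed

text \<open>\<open>\<phi>\<close> identifies the complete graph on \<open>m + 1\<close> vertices
  with the one induced on \<open>V\<close>. Monotonicity preserves edge directions; the two endpoint
  conditions match the flow requirements at source and sink.\<close>

locale vertex_relabeling =
  fixes m n :: nat and V :: "nat set" and \<phi> :: "nat \<Rightarrow> nat"
  assumes bij: "bij_betw \<phi> {1..m+1} V"
    and mono: "strict_mono_on {1..m+1} \<phi>"
    and V: "V \<subseteq> {1..n+1}"
    and source: "\<phi> 1 = 1"
    and sink: "\<phi> (m + 1) = n + 1"
begin

lemma mem_V: "i \<in> {1..m+1} \<Longrightarrow> \<phi> i \<in> V"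
  using bij by (auto simp: bij_betw_def)

lemma less_iff: "i \<in> {1..m+1} \<Longrightarrow> j \<in> {1..m+1} \<Longrightarrow> \<phi> i < \<phi> j \<longleftrightarrow> i < j"
  using mono by (rule strict_mono_on_less)

lemma eq_iff: "i \<in> {1..m+1} \<Longrightarrow> j \<in> {1..m+1} \<Longrightarrow> \<phi> i = \<phi> j \<longleftrightarrow> i = j"
  using less_iff[of i j] less_iff[of j i] by auto

lemma arc_iff:
  assumes "i \<in> {1..m+1}" "j \<in> {1..m+1}"
  shows "(\<phi> i, \<phi> j) \<in> parcs (complete_dag n) \<longleftrightarrow> (i, j) \<in> parcs (complete_dag m)"
  using assms less_iff[OF assms] mem_V[OF assms(1)] mem_V[OF assms(2)] V by auto

lemma inj_on_arcs: "inj_on (map_prod \<phi> \<phi>) ({1..m+1} \<times> {1..m+1})"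
  using bij by (intro map_prod_inj_on) (auto simp: bij_betw_def)

lemma arcs_subset: "parcs (complete_dag m) \<subseteq> {1..m+1} \<times> {1..m+1}"
  by auto

text \<open>\<open>f\<close> is the transport of \<open>f'\<close> along \<open>\<phi>\<close>.
  Fixing both flows lets the same facts serve for pushing forward and for pulling back. The values
  agree on all pairs of vertices, also where both vanish, so full sums can be compared.\<close>

context
  fixes f f' :: "nat \<times> nat \<Rightarrow>\<^sub>0 real"
  assumes keys': "Poly_Mapping.keys f' \<subseteq> parcs (complete_dag m)"
    and keys: "Poly_Mapping.keys f = map_prod \<phi> \<phi> ` Poly_Mapping.keys f'"
    and eq: "\<And>e. e \<in> {1..m+1} \<times> {1..m+1} \<Longrightarrow>
      Poly_Mapping.lookup f (map_prod \<phi> \<phi> e) = Poly_Mapping.lookup f' e"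
begin

lemma keys_subset: "Poly_Mapping.keys f \<subseteq> parcs (complete_dag n)" "Poly_Mapping.keys f \<subseteq> V \<times> V"
proof -
  have "map_prod \<phi> \<phi> e \<in> parcs (complete_dag n) \<inter> V \<times> V" if "e \<in> Poly_Mapping.keys f'" for e
  proof -
    obtain i j where e: "e = (i, j)" by force
    then have ij: "(i, j) \<in> parcs (complete_dag m)" using that keys' by blast
    then have "i \<in> {1..m+1}" "j \<in> {1..m+1}" by auto
    then show ?thesis using arc_iff ij mem_V by (simp add: e)
  qed
  then have "Poly_Mapping.keys f \<subseteq> parcs (complete_dag n) \<inter> V \<times> V"
    unfolding keys by (rule image_subsetI)
  then show "Poly_Mapping.keys f \<subseteq> parcs (complete_dag n)" "Poly_Mapping.keys f \<subseteq> V \<times> V"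
    by blast+
qed

lemma netflow_relabel:
  assumes "i \<in> {1..m+1}"
  shows "netflow n f (\<phi> i) = netflow m f' i"
proof -
  have "netflow n f (\<phi> i) =
      (\<Sum>j\<in>V. Poly_Mapping.lookup f (\<phi> i, j)) - (\<Sum>j\<in>V. Poly_Mapping.lookup f (j, \<phi> i))"
    by (rule netflow_eq_sum_vertices[OF keys_subset(1) V keys_subset(2)])
  also have "\<dots> = (\<Sum>j\<in>{1..m+1}. Poly_Mapping.lookup f (\<phi> i, \<phi> j))
      - (\<Sum>j\<in>{1..m+1}. Poly_Mapping.lookup f (\<phi> j, \<phi> i))"
    by (simp only: sum.reindex_bij_betw[OF bij, symmetric])
  also have "\<dots> = (\<Sum>j\<in>{1..m+1}. Poly_Mapping.lookup f' (i, j))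
      - (\<Sum>j\<in>{1..m+1}. Poly_Mapping.lookup f' (j, i))"
    using eq assms by (intro arg_cong2[where f = "(-)"] sum.cong) force+
  also have "\<dots> = netflow m f' i"
    using keys' arcs_subset by (intro netflow_eq_sum_vertices[symmetric]) auto
  finally show ?thesis .
qed

text \<open>Vertices outside \<open>V\<close> are isolated in the support, so conservation holds
  there trivially.\<close>

lemma netflow_off_V:
  assumes "v \<notin> V"
  shows "netflow n f v = 0"
proof -
  have "(\<Sum>j\<in>V. Poly_Mapping.lookup f (v, j)) = 0" "(\<Sum>j\<in>V. Poly_Mapping.lookup f (j, v)) = 0"
    using assms keys_subset(2) by (auto simp: in_keys_iff intro!: sum.neutral)
  then show ?thesis
    using netflow_eq_sum_vertices[OF keys_subset(1) V keys_subset(2), of v] by simp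
qed

lemma nonneg_relabel:
  "(\<forall>e\<in>parcs (complete_dag n). 0 \<le> Poly_Mapping.lookup f e) \<longleftrightarrow>
    (\<forall>e\<in>parcs (complete_dag m). 0 \<le> Poly_Mapping.lookup f' e)" (is "?L \<longleftrightarrow> ?R")
proof
  assume ?L
  show ?R
  proof
    fix e assume e: "e \<in> parcs (complete_dag m)"
    then obtain i j where ij: "e = (i, j)" "i \<in> {1..m+1}" "j \<in> {1..m+1}" using arcs_subset by blast
    then have "map_prod \<phi> \<phi> e \<in> parcs (complete_dag n)" using arc_iff e by simp
    with \<open>?L\<close> have "0 \<le> Poly_Mapping.lookup f (map_prod \<phi> \<phi> e)" by blast
    then show "0 \<le> Poly_Mapping.lookup f' e" by (simp only: eq[OF subsetD[OF arcs_subset e]])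
  qed
next
  assume ?R
  show ?L
  proof
    fix e assume "e \<in> parcs (complete_dag n)"
    show "0 \<le> Poly_Mapping.lookup f e"
    proof (cases "e \<in> Poly_Mapping.keys f")
      case True
      then obtain e' where e': "e = map_prod \<phi> \<phi> e'" "e' \<in> Poly_Mapping.keys f'"
        unfolding keys by (rule imageE)
      then have "e' \<in> parcs (complete_dag m)" using keys' by blast
      then show ?thesis
        using \<open>?R\<close> unfolding e'(1) by (simp only: eq[OF subsetD[OF arcs_subset]])
    qed (simp add: in_keys_iff)
  qed
qed

lemma unit_flow_relabel: "unit_flow n f \<longleftrightarrow> unit_flow m f'"
proof -
  have "(\<forall>v\<in>{1..n}. netflow n f v = (if v = 1 then 1 else 0)) \<longleftrightarrow>
      (\<forall>i\<in>{1..m}. netflow m f' i = (if i = 1 then 1 else 0))" (is "?L \<longleftrightarrow> ?R")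
  proof
    assume ?L
    show ?R
    proof
      fix i assume i: "i \<in> {1..m}"
      \<comment> \<open>Since \<open>i\<close> lies below \<open>m + 1\<close>, its image lies below
        the sink and is thus a vertex with a flow condition.\<close>
      then have "\<phi> i < n + 1" "\<phi> i \<in> V" using less_iff[of i "m + 1"] mem_V[of i] sink by auto
      then have "\<phi> i \<in> {1..n}" using V by auto
      then show "netflow m f' i = (if i = 1 then 1 else 0)"
        using \<open>?L\<close> netflow_relabel[of i] i eq_iff[of i 1] source by auto
    qed
  next
    assume ?R
    show ?L
    proof
      fix v assume v: "v \<in> {1..n}"
      show "netflow n f v = (if v = 1 then 1 else 0)"
      proof (cases "v \<in> V")
        case True
        then obtain i where i: "i \<in> {1..m+1}" "v = \<phi> i" using bij by (auto simp: bij_betw_def)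
        moreover have "i \<noteq> m + 1" using i v sink by auto
        ultimately have "i \<in> {1..m}" by auto
        then show ?thesis using \<open>?R\<close> netflow_relabel[of i] i eq_iff[of i 1] source by auto
      next
        case False
        \<comment> \<open>A vertex off \<open>V\<close> is therefore not the source, and its
          required netflow is 0.\<close>
        moreover have "1 \<in> V" using mem_V[of 1] source by simp
        ultimately show ?thesis using netflow_off_V by auto
      qed
    qed
  qed
  then show ?thesis
    using keys_subset(1) keys' nonneg_relabel unfolding unit_flow_def by blast
qed

end

lemma flow_support_relabel:
  assumes E': "E' \<subseteq> parcs (complete_dag m)"
  shows "flow_support n (map_prod \<phi> \<phi> ` E') \<longleftrightarrow> flow_support m E'"
proof
  have fin: "finite E'" using E' finite_parcs_complete_dag by (rule finite_subset)
  have sub: "E' \<subseteq> {1..m+1} \<times> {1..m+1}" using E' arcs_subset by blast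
  have mem_iff: "map_prod \<phi> \<phi> e \<in> map_prod \<phi> \<phi> ` E' \<longleftrightarrow> e \<in> E'" if "e \<in> {1..m+1} \<times> {1..m+1}" for e
    by (rule inj_on_image_mem_iff[OF inj_on_arcs that sub])
  {
    assume "flow_support n (map_prod \<phi> \<phi> ` E')"
    then obtain f where f: "unit_flow n f" "Poly_Mapping.keys f = map_prod \<phi> \<phi> ` E'"
      by (auto simp: flow_support_def)
    \<comment> \<open>The cutoff at \<open>E'\<close> matters: outside \<open>{1..m+1}\<close>
      nothing is known about \<open>\<phi>\<close>, and a plain pullback could pick up spurious or
      infinitely many nonzero values.\<close>
    obtain f' where "Poly_Mapping.lookup f' =
        (\<lambda>e. if e \<in> E' then Poly_Mapping.lookup f (map_prod \<phi> \<phi> e) else 0)"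
      using ex_poly_mapping_of_finite[OF fin] by metis
    note f' = fun_cong[OF this]
    have eq: "Poly_Mapping.lookup f (map_prod \<phi> \<phi> e) = Poly_Mapping.lookup f' e"
      if "e \<in> {1..m+1} \<times> {1..m+1}" for e
      using mem_iff[OF that] f(2) f'[of e] by (metis in_keys_iff)
    have keys': "Poly_Mapping.keys f' = E'"
    proof (intro set_eqI)
      fix e
      have "map_prod \<phi> \<phi> e \<in> Poly_Mapping.keys f" if "e \<in> E'"
        unfolding f(2) using that by (rule imageI)
      then show "e \<in> Poly_Mapping.keys f' \<longleftrightarrow> e \<in> E'" using f'[of e] by (auto simp: in_keys_iff)
    qed
    have "unit_flow m f'"
      using unit_flow_relabel[of f' f] eq E' f keys' by simp
    then show "flow_support m E'" using keys' by (auto simp: flow_support_def)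
  }
  {
    assume "flow_support m E'"
    then obtain f' where f': "unit_flow m f'" "Poly_Mapping.keys f' = E'"
      by (auto simp: flow_support_def)
    let ?inv = "the_inv_into ({1..m+1} \<times> {1..m+1}) (map_prod \<phi> \<phi>)"
    have inv: "?inv (map_prod \<phi> \<phi> e) = e" if "e \<in> {1..m+1} \<times> {1..m+1}" for e
      by (rule the_inv_into_f_f[OF inj_on_arcs that])
    obtain f where "Poly_Mapping.lookup f =
        (\<lambda>e. if e \<in> map_prod \<phi> \<phi> ` E' then Poly_Mapping.lookup f' (?inv e) else 0)"
      using ex_poly_mapping_of_finite[OF finite_imageI[OF fin]] by metis
    note f = fun_cong[OF this]
    have eq: "Poly_Mapping.lookup f (map_prod \<phi> \<phi> e) = Poly_Mapping.lookup f' e"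
      if "e \<in> {1..m+1} \<times> {1..m+1}" for e
      using mem_iff[OF that] f'(2) f[of "map_prod \<phi> \<phi> e"] inv[OF that] by (metis in_keys_iff)
    have keys: "Poly_Mapping.keys f = map_prod \<phi> \<phi> ` E'"
    proof (intro set_eqI)
      fix k
      have "Poly_Mapping.lookup f' (?inv k) \<noteq> 0" if k: "k \<in> map_prod \<phi> \<phi> ` E'"
      proof -
        obtain e where "k = map_prod \<phi> \<phi> e" "e \<in> E'" using k by (rule imageE)
        then show ?thesis using inv[of e] sub f'(2) by (metis in_keys_iff subsetD)
      qed
      then show "k \<in> Poly_Mapping.keys f \<longleftrightarrow> k \<in> map_prod \<phi> \<phi> ` E'"
        using f[of k] by (auto simp: in_keys_iff)
    qed
    have "unit_flow n f"
      using unit_flow_relabel[of f' f] eq E' f' keys by simp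
    then show "flow_support n (map_prod \<phi> \<phi> ` E')" using keys by (auto simp: flow_support_def)
  }
qed

lemma card_supports_relabel:
  "card {E. flow_support n E \<and> edge_verts E = V \<and> card E = c} =
    card {E. flow_support m E \<and> edge_verts E = {1..m+1} \<and> card E = c}"
  (is "card ?A = card ?B")
proof -
  let ?\<Phi> = "map_prod \<phi> \<phi>" and ?S = "{1..m+1} \<times> {1..m+1}"
  have verts: "edge_verts (?\<Phi> ` E) = \<phi> ` edge_verts E" for E
    by (force simp: edge_verts_def image_Un image_image)
  have sub: "E \<subseteq> ?S" if "flow_support m E" for E
    using flow_support_subset[OF that] arcs_subset by blast
  have card: "card (?\<Phi> ` E) = card E" if "E \<subseteq> ?S" for E
    by (rule card_image) (rule inj_on_subset[OF inj_on_arcs that])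
  have img: "\<phi> ` {1..m+1} = V" using bij by (simp add: bij_betw_def)
  have "?A = (`) ?\<Phi> ` ?B"
  proof (intro equalityI subsetI)
    fix E assume E: "E \<in> ?A"
    \<comment> \<open>The preimage is taken inside \<open>?S\<close>, where \<open>\<phi>\<close> is
      known to be injective.\<close>
    define E' where "E' = {e \<in> ?S. ?\<Phi> e \<in> E}"
    have "E \<subseteq> V \<times> V" using E by (force simp: edge_verts_def)
    also have "V \<times> V = ?\<Phi> ` ?S" using img by (auto simp: map_prod_surj_on)
    finally have E_sub: "E \<subseteq> ?\<Phi> ` ?S" .
    have im: "?\<Phi> ` E' = E"
    proof (intro equalityI subsetI)
      fix x assume x: "x \<in> E"
      with E_sub have "x \<in> ?\<Phi> ` ?S" by (rule subsetD)
      then obtain e where e: "x = ?\<Phi> e" "e \<in> ?S" by (rule imageE)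
      then have "e \<in> E'" using x by (simp add: E'_def)
      then show "x \<in> ?\<Phi> ` E'" unfolding e(1) by (rule imageI)
    qed (auto simp: E'_def)
    have "E' \<subseteq> ?S" by (auto simp: E'_def)
    have "E' \<subseteq> parcs (complete_dag m)"
    proof
      fix e assume "e \<in> E'"
      then obtain i j where "e = (i, j)" "i \<in> {1..m+1}" "j \<in> {1..m+1}" "(\<phi> i, \<phi> j) \<in> E"
        by (auto simp: E'_def)
      then show "e \<in> parcs (complete_dag m)" using arc_iff[of i j] flow_support_subset[of n E] E by blast
    qed
    then have "flow_support m E'" using flow_support_relabel[of E'] im E by auto
    moreover have "edge_verts E' = {1..m+1}"
    proof (rule inj_on_image_eq_iff[THEN iffD1])
      show "inj_on \<phi> {1..m+1}" using bij by (simp add: bij_betw_def)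
      show "\<phi> ` edge_verts E' = \<phi> ` {1..m+1}" using verts[of E'] im img E by simp
      show "edge_verts E' \<subseteq> {1..m+1}" using \<open>E' \<subseteq> ?S\<close> by (force simp: edge_verts_def)
    qed simp
    moreover have "card E' = c" using card[OF \<open>E' \<subseteq> ?S\<close>] im E by simp
    ultimately show "E \<in> (`) ?\<Phi> ` ?B" using im by blast
  next
    fix E assume "E \<in> (`) ?\<Phi> ` ?B"
    then obtain E' where E': "flow_support m E'" "edge_verts E' = {1..m+1}" "card E' = c" "E = ?\<Phi> ` E'"
      by blast
    then show "E \<in> ?A"
      using flow_support_relabel[OF flow_support_subset[OF E'(1)]] card[OF sub[OF E'(1)]] verts[of E'] img
      by simp
  qed
  moreover have "inj_on ((`) ?\<Phi>) ?B"
    using sub by (intro inj_on_subset[OF inj_on_image_Pow[OF inj_on_arcs]]) blast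
  ultimately show ?thesis by (simp only: card_image)
qed

end

text \<open>Enumerate \<open>V\<close> increasingly; since \<open>V\<close> lies in
  \<open>{1..n+1}\<close>, the vertices 1 and \<open>n + 1\<close> are its least and greatest
  elements and come first and last.\<close>

lemma ex_vertex_relabeling:
  assumes "V \<subseteq> {1..n+1}" "1 \<in> V" "n + 1 \<in> V" "card V = m + 1"
  shows "\<exists>\<phi>. vertex_relabeling m n V \<phi>"
proof -
  have "finite V" using assms(1) by (rule finite_subset) simp
  then obtain h where h: "bij_betw h {..<m+1} V" "strict_mono_on {..<m+1} h"
    using ex_bij_betw_strict_mono_card[of V] assms(4) by metis
  \<comment> \<open>The enumeration \<open>h\<close> starts at 0, the vertices at 1.\<close>
  define \<phi> where "\<phi> i = h (i - 1)" for i
  have bij: "bij_betw \<phi> {1..m+1} V"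
  proof -
    have "bij_betw (\<lambda>i. i - 1) {1..m+1} {..<m+1}"
      by (rule bij_betw_byWitness[where f' = Suc]) auto
    from bij_betw_trans[OF this h(1)] show ?thesis by (simp add: \<phi>_def[abs_def] o_def)
  qed
  have mono: "strict_mono_on {1..m+1} \<phi>"
  proof (rule strict_mono_onI)
    fix r s assume "r \<in> {1..m+1}" "s \<in> {1..m+1}" "r < s"
    then show "\<phi> r < \<phi> s" unfolding \<phi>_def by (intro strict_mono_onD[OF h(2)]) auto
  qed
  have less: "i \<le> j" if "\<phi> i \<le> \<phi> j" "i \<in> {1..m+1}" "j \<in> {1..m+1}" for i j
    using strict_mono_on_less_eq[OF mono that(2,3)] that(1) by simp
  have mem: "\<phi> i \<in> {1..n+1}" if "i \<in> {1..m+1}" for i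
    using bij_betwE[OF bij] assms(1) that by blast
  obtain i where i: "i \<in> {1..m+1}" "\<phi> i = 1" using bij assms(2) by (auto simp: bij_betw_def)
  have "\<phi> i \<le> \<phi> 1" using i(2) mem[of 1] by simp
  then have "i = 1" using less[of i 1] i(1) by simp
  obtain j where j: "j \<in> {1..m+1}" "\<phi> j = n + 1" using bij assms(3) by (auto simp: bij_betw_def)
  have "\<phi> (m + 1) \<le> \<phi> j" using j(2) mem[of "m + 1"] by simp
  then have "j = m + 1" using less[of "m + 1" j] j(1) by simp
  have "vertex_relabeling m n V \<phi>"
    using bij mono assms(1) i j \<open>i = 1\<close> \<open>j = m + 1\<close> by unfold_locales auto
  then show ?thesis by blast
qed

section \<open>Counting primitive subgraphs\<close>

text \<open>A unit flow is nonnegative and lives on the edges, so its positive edges are exactly its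
  keys; the subgraph condition then follows from the support.\<close>

lemma valid_subgraph_iff:
  "valid_subgraph n H \<longleftrightarrow> flow_support n (parcs H) \<and> pverts H = edge_verts (parcs H)"
proof -
  have keys: "{e \<in> parcs (complete_dag n). 0 < Poly_Mapping.lookup f e} = Poly_Mapping.keys f"
    if "unit_flow n f" for f
  proof (intro set_eqI iffI)
    fix e assume "e \<in> Poly_Mapping.keys f"
    then show "e \<in> {e \<in> parcs (complete_dag n). 0 < Poly_Mapping.lookup f e}"
      using that unit_flow_pos[OF that, of e] unfolding unit_flow_def by blast
  qed (simp add: in_keys_iff)
  have "subgraph (with_proj H) (with_proj (complete_dag n))"
    if "flow_support n (parcs H)" "pverts H = edge_verts (parcs H)"
  proof -
    have "wf_digraph (with_proj (complete_dag n))" by unfold_locales (auto simp: complete_dag_def)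
    moreover have "wf_digraph (with_proj H)"
      by unfold_locales (auto simp: that(2) edge_verts_def)
    moreover have "pverts H \<subseteq> pverts (complete_dag n)"
      using flow_support_verts[OF that(1)] that(2) by (simp add: complete_dag_def)
    ultimately show ?thesis
      using flow_support_subset[OF that(1)] compatibleI_with_proj unfolding subgraph_def by simp
  qed
  then show ?thesis
    using keys unfolding valid_subgraph_def flow_support_def edge_verts_def by (metis (no_types, lifting))
qed

lemma connected_valid_subgraph:
  assumes "valid_subgraph n H" "n \<ge> 1"
  shows "Digraph_Component.connected (with_proj H)" "num_components H = 1"
proof -
  have H: "flow_support n (parcs H)" "pverts H = edge_verts (parcs H)"
    using assms(1) by (auto simp: valid_subgraph_iff)
  have wf: "pair_wf_digraph H" by unfold_locales (auto simp: H(2) edge_verts_def)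
  show *: "Digraph_Component.connected (with_proj H)"
  proof (rule connected_if_incoming[OF wf])
    show "1 \<in> pverts H" using flow_support_source[OF H(1) assms(2)] H(2) by simp
    show "i < j" if "(i, j) \<in> parcs H" for i j using flow_support_subset[OF H(1)] that by auto
    show "\<exists>i. (i, j) \<in> parcs H" if "j \<in> pverts H" "j \<noteq> 1" for j
      using flow_support_incoming[OF H(1)] that H(2) by simp
  qed
  show "num_components H = 1" by (rule num_components_connected[OF wf *])
qed

text \<open>With \<open>n + 1\<close> vertices and one component, Betti number \<open>d\<close>
  means \<open>n + d\<close> edges. The vertex set is prescribed, so the subgraph is determined by
  its edges.\<close>

lemma primitive_f_vector_eq_card_supports:
  assumes "n \<ge> 1"
  shows "primitive_f_vector n d =
    card {E. flow_support n E \<and> edge_verts E = {1..n+1} \<and> card E = n + d}"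
    (is "_ = card ?B")
proof -
  let ?A = "{H. valid_subgraph n H \<and> primitive_subgraph n H \<and> betti1 H = int d}"
  have A: "H \<in> ?A \<longleftrightarrow> parcs H \<in> ?B \<and> pverts H = {1..n+1}" for H
  proof -
    have "betti1 H = int d \<longleftrightarrow> card (parcs H) = n + d"
      if "valid_subgraph n H" "pverts H = {1..n+1}"
      using connected_valid_subgraph(2)[OF that(1) assms] that(2) by (auto simp: betti1_def)
    then show ?thesis
      using connected_valid_subgraph(1)[of n H] assms
      by (auto simp: valid_subgraph_iff primitive_subgraph_def complete_dag_def)
  qed
  have "bij_betw parcs ?A ?B"
  proof (rule bij_betw_byWitness[where f' = "\<lambda>E. \<lparr> pverts = {1..n+1}, parcs = E \<rparr>"])
    show "\<forall>H\<in>?A. \<lparr> pverts = {1..n+1}, parcs = parcs H \<rparr> = H"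
    proof
      fix H assume "H \<in> ?A"
      then have "pverts H = {1..n+1}" using A by blast
      then show "\<lparr> pverts = {1..n+1}, parcs = parcs H \<rparr> = H" by (cases H) simp
    qed
    show "(\<lambda>E. \<lparr> pverts = {1..n+1}, parcs = E \<rparr>) ` ?B \<subseteq> ?A"
    proof (rule image_subsetI)
      fix E assume "E \<in> ?B"
      then show "\<lparr> pverts = {1..n+1}, parcs = E \<rparr> \<in> ?A" unfolding A by simp
    qed
    show "parcs ` ?A \<subseteq> ?B" using A by blast
  qed simp
  then show ?thesis unfolding primitive_f_vector_def by (rule bij_betw_same_card)
qed

lemma sum_Pow_card:
  fixes g :: "nat \<Rightarrow> nat"
  assumes "finite S"
  shows "(\<Sum>U\<in>Pow S. g (card U)) = (\<Sum>i=0..card S. (card S choose i) * g i)"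
proof -
  have "(\<Sum>U\<in>Pow S. g (card U)) = (\<Sum>i=0..card S. \<Sum>U\<in>{U \<in> Pow S. card U = i}. g (card U))"
    using assms by (intro sum.group[symmetric]) (auto simp: card_mono)
  also have "\<dots> = (\<Sum>i=0..card S. (card S choose i) * g i)"
    using n_subsets[OF assms] by (intro sum.cong) (auto simp: Pow_def)
  finally show ?thesis .
qed

theorem corollary4p3:
  fixes n d :: nat
  assumes "n \<ge> 1"
  shows "f_vector n d = (\<Sum>i=0..n-1. ((n - 1) choose i) * primitive_f_vector (n - i) d)"
proof -
  \<comment> \<open>\<open>U\<close> is the set of vertices missed by the support.\<close>
  define A where "A U = {E. flow_support n E \<and> edge_verts E = {1..n+1} - U \<and>
    card E + 1 = card ({1..n+1} - U) + d}" for U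
  have cardA: "card (A U) = primitive_f_vector (n - card U) d" if U: "U \<in> Pow {2..n}" for U
  proof -
    \<comment> \<open>This bound keeps the smaller graph at parameter at least 1, as the count of
      primitive subgraphs by supports demands.\<close>
    have "card U \<le> n - 1" using card_mono[of "{2..n}" U] that by simp
    moreover have "card ({1..n+1} - U) = n + 1 - card U"
      using that by (subst card_Diff_subset) (auto intro: finite_subset)
    ultimately have m: "n - card U \<ge> 1" "card ({1..n+1} - U) = n - card U + 1" using assms by auto
    obtain \<phi> where "vertex_relabeling (n - card U) n ({1..n+1} - U) \<phi>"
      using ex_vertex_relabeling[of "{1..n+1} - U" n "n - card U"] m U assms by fastforce
    then interpret vertex_relabeling "n - card U" n "{1..n+1} - U" \<phi> .
    have "A U = {E. flow_support n E \<and> edge_verts E = {1..n+1} - U \<and> card E = n - card U + d}"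
      unfolding A_def m(2) by auto
    then show ?thesis
      using card_supports_relabel[of "n - card U + d"] primitive_f_vector_eq_card_supports[OF m(1)]
      by simp
  qed
  \<comment> \<open>Every support meets 1 and \<open>n + 1\<close>, so the missed set lies in
    \<open>{2..n}\<close>, which has \<open>n - 1\<close> elements.\<close>
  have "{E. flow_support n E \<and> card E + 1 = card (edge_verts E) + d} = (\<Union>U\<in>Pow {2..n}. A U)"
  proof (intro equalityI subsetI)
    fix E assume E: "E \<in> {E. flow_support n E \<and> card E + 1 = card (edge_verts E) + d}"
    then have V: "edge_verts E \<subseteq> {1..n+1}" "1 \<in> edge_verts E" "n + 1 \<in> edge_verts E"
      using flow_support_verts flow_support_source flow_support_sink assms by blast+
    define U where "U = {1..n+1} - edge_verts E"
    have "edge_verts E = {1..n+1} - U" using V(1) by (auto simp: U_def)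
    then have "E \<in> A U" using E by (simp add: A_def)
    moreover have "u \<in> {2..n}" if "u \<in> U" for u
    proof -
      have "u \<noteq> 1" "u \<noteq> n + 1" "1 \<le> u" "u \<le> n + 1" using that V by (auto simp: U_def)
      then show ?thesis by simp
    qed
    ultimately show "E \<in> (\<Union>U\<in>Pow {2..n}. A U)" by blast
  next
    fix E assume "E \<in> (\<Union>U\<in>Pow {2..n}. A U)"
    then show "E \<in> {E. flow_support n E \<and> card E + 1 = card (edge_verts E) + d}"
      by (auto simp: A_def)
  qed
  moreover have "card (\<Union>U\<in>Pow {2..n}. A U) = (\<Sum>U\<in>Pow {2..n}. card (A U))"
  proof (rule card_UN_disjoint)
    show "\<forall>U\<in>Pow {2..n}. finite (A U)"
      using finite_flow_supports[of n] by (auto simp: A_def elim: rev_finite_subset)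
    show "\<forall>U\<in>Pow {2..n}. \<forall>U'\<in>Pow {2..n}. U \<noteq> U' \<longrightarrow> A U \<inter> A U' = {}"
    proof (intro ballI impI)
      fix U U' assume U: "U \<in> Pow {2..n}" "U' \<in> Pow {2..n}" "U \<noteq> U'"
      \<comment> \<open>Different missed sets give different vertex sets, hence disjoint classes of
        supports.\<close>
      have "{1..n+1} - U \<noteq> {1..n+1} - U'"
        using U double_diff[of U "{1..n+1}" "{1..n+1}"] double_diff[of U' "{1..n+1}" "{1..n+1}"] by fastforce
      then show "A U \<inter> A U' = {}" by (auto simp: A_def)
    qed
  qed simp
  ultimately have "f_vector n d = (\<Sum>U\<in>Pow {2..n}. primitive_f_vector (n - card U) d)"
    using f_vector_eq_card_supports[OF assms] cardA by simp
  also have "\<dots> = (\<Sum>i=0..n-1. ((n - 1) choose i) * primitive_f_vector (n - i) d)"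
    using sum_Pow_card[of "{2..n}" "\<lambda>i. primitive_f_vector (n - i) d"] by simp
  finally show ?thesis .
qed

end
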